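(* For every $d\ge1$ and every prime $p$: (1) $a_d(p)\equiv1\pmod p$; (2) $a_d(p^k)\equiv a_d(p^{k-1})\pmod{p^k}$ for every $k\ge2$ (equivalently, $\nu_p\bigl(a_d(p^k)-a_d(p^{k-1})\bigr)\ge k$).
   Context: For integers $d,n\ge1$, $T_d(n)$ is the Cayley graph of $(\mathbb{Z}/n\mathbb{Z})^d$ with respect to $\{\pm e_1,\dots,\pm e_d\}\setminus\{0\}$ ($e_i$ the standard basis vectors); it is a simple graph. $a_d(n)$ is the number of independent sets of $T_d(n)$ (including the empty set). $\nu_p$ is the $p$-adic valuation with $\nu_p(p)=1$. *)

theory Defs
  imports
    "HOL-Algebra.Product_Groups"
    "HOL-Number_Theory.Cong"
    "HOL-Computational_Algebra.Primes"
    "Graph_Theory.Pair_Digraph"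
begin

text \<open>
  An undirected graph is represented, as in the theory of digraphs, by the symmetric set of
  its ordered pairs of adjacent vertices.
\<close>

definition cayley_graph :: "('a, 'b) monoid_scheme \<Rightarrow> 'a set \<Rightarrow> 'a pair_pre_digraph" where
  "cayley_graph G S =
     \<lparr> pverts = carrier G,
       parcs = {(x, y). x \<in> carrier G \<and> y \<in> carrier G \<and> (\<exists>s\<in>S. y = x \<otimes>\<^bsub>G\<^esub> s)} \<rparr>"

definition independent_set :: "'a pair_pre_digraph \<Rightarrow> 'a set \<Rightarrow> bool" where
  "independent_set H I \<longleftrightarrow> I \<subseteq> pverts H \<and> (\<forall>u\<in>I. \<forall>v\<in>I. (u, v) \<notin> parcs H)"

definition torus_group :: "nat \<Rightarrow> nat \<Rightarrow> (nat \<Rightarrow> int) monoid" where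
  "torus_group d n = product_group {..<d} (\<lambda>_. integer_mod_group n)"

text \<open>The residue of 1 is written \<open>1 mod n\<close>, so that the unit vectors are zero for \<open>n = 1\<close>.\<close>

definition unit_vec :: "nat \<Rightarrow> nat \<Rightarrow> nat \<Rightarrow> (nat \<Rightarrow> int)" where
  "unit_vec d n i = (\<lambda>j\<in>{..<d}. if j = i then 1 mod int n else 0)"

definition torus_gens :: "nat \<Rightarrow> nat \<Rightarrow> (nat \<Rightarrow> int) set" where
  "torus_gens d n =
     (unit_vec d n ` {..<d} \<union> (\<lambda>i. inv\<^bsub>torus_group d n\<^esub> (unit_vec d n i)) ` {..<d})
       - {\<one>\<^bsub>torus_group d n\<^esub>}"

definition torus_graph :: "nat \<Rightarrow> nat \<Rightarrow> (nat \<Rightarrow> int) pair_pre_digraph" where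
  "torus_graph d n = cayley_graph (torus_group d n) (torus_gens d n)"

definition num_indep_sets :: "nat \<Rightarrow> nat \<Rightarrow> nat" where
  "num_indep_sets d n = card {I. independent_set (torus_graph d n) I}"

lemma group_torus_group: "group (torus_group d n)"
  by (simp add: torus_group_def)

lemma unit_vec_closed: "n \<ge> 1 \<Longrightarrow> unit_vec d n i \<in> carrier (torus_group d n)"
  by (auto simp: torus_group_def unit_vec_def carrier_integer_mod_group)

lemma torus_gens_closed:
  assumes "n \<ge> 1"
  shows "torus_gens d n \<subseteq> carrier (torus_group d n)"
  using unit_vec_closed[OF assms] group.inv_closed[OF group_torus_group]
  by (auto simp: torus_gens_def)

lemma torus_gens_inv:
  assumes "n \<ge> 1" "s \<in> torus_gens d n"
  shows "inv\<^bsub>torus_group d n\<^esub> s \<in> torus_gens d n"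
proof -
  interpret group "torus_group d n" by (rule group_torus_group)
  have "s \<in> carrier (torus_group d n)"
    using torus_gens_closed assms by blast
  from assms(2) obtain i where i: "i < d"
      "s = unit_vec d n i \<or> s = inv\<^bsub>torus_group d n\<^esub> (unit_vec d n i)"
    and ne: "s \<noteq> \<one>\<^bsub>torus_group d n\<^esub>"
    unfolding torus_gens_def by blast
  have "inv\<^bsub>torus_group d n\<^esub> s \<noteq> \<one>\<^bsub>torus_group d n\<^esub>"
    using ne \<open>s \<in> carrier _\<close> inv_eq_1_iff by blast
  moreover have "inv\<^bsub>torus_group d n\<^esub> (inv\<^bsub>torus_group d n\<^esub> (unit_vec d n i)) = unit_vec d n i"
    by (rule inv_inv) (rule unit_vec_closed[OF assms(1)])
  ultimately show ?thesis
    using i unfolding torus_gens_def by blast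
qed

lemma pair_graph_torus_graph:
  assumes "n \<ge> 1"
  shows "pair_graph (torus_graph d n)"
proof -
  let ?G = "torus_group d n"
  interpret group ?G by (rule group_torus_group)
  have fin: "finite (carrier ?G)"
    using assms by (auto simp: torus_group_def carrier_integer_mod_group intro!: finite_PiE)
  show ?thesis
  proof
    fix e assume e: "e \<in> parcs (torus_graph d n)"
    then show "fst e \<in> pverts (torus_graph d n)" "snd e \<in> pverts (torus_graph d n)"
      by (auto simp: torus_graph_def cayley_graph_def)
    from e obtain s where s: "s \<in> torus_gens d n" "snd e = fst e \<otimes>\<^bsub>?G\<^esub> s" "fst e \<in> carrier ?G"
      by (auto simp: torus_graph_def cayley_graph_def)
    have "s \<in> carrier ?G" "s \<noteq> \<one>\<^bsub>?G\<^esub>"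
      using torus_gens_closed[OF assms] s(1) by (auto simp: torus_gens_def)
    then show "fst e \<noteq> snd e"
      using s r_cancel_one' by force
  next
    show "finite (pverts (torus_graph d n))"
      using fin by (simp add: torus_graph_def cayley_graph_def)
    show "finite (parcs (torus_graph d n))"
      by (rule finite_subset[of _ "carrier ?G \<times> carrier ?G"])
         (use fin in \<open>auto simp: torus_graph_def cayley_graph_def\<close>)
  next
    have "(y, x) \<in> parcs (torus_graph d n)" if "(x, y) \<in> parcs (torus_graph d n)" for x y
    proof -
      from that obtain s where s: "s \<in> torus_gens d n" "y = x \<otimes>\<^bsub>?G\<^esub> s"
        and xy: "x \<in> carrier ?G" "y \<in> carrier ?G"
        by (auto simp: torus_graph_def cayley_graph_def)
      have sc: "s \<in> carrier ?G"
        using torus_gens_closed[OF assms] s(1) by auto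
      have "x = y \<otimes>\<^bsub>?G\<^esub> inv\<^bsub>?G\<^esub> s"
        using s(2) xy sc by (simp add: m_assoc)
      then show ?thesis
        using torus_gens_inv[OF assms s(1)] xy
        by (auto simp: torus_graph_def cayley_graph_def)
    qed
    then show "symmetric (with_proj (torus_graph d n))"
      unfolding symmetric_def by (auto simp: arcs_ends_def arc_to_ends_def intro!: symI)
  qed
qed

end

theory Submission
  imports Defs
begin

text \<open>
  For \<open>n \<ge> 2\<close> an independent set of \<open>T\<^sub>d(n)\<close> is the same as a subset of \<open>\<int>\<^sup>d\<close> that is
  \<open>n\<close>-periodic in every coordinate and never contains both \<open>x\<close> and \<open>x + e\<^sub>i\<close>. More generally one
  may allow a different period \<open>m\<^sub>i\<close> in each coordinate. If \<open>m\<^sub>j = p\<^sup>k\<close>, then translation by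
  \<open>e\<^sub>j\<close> generates an action of the cyclic group of order \<open>p\<^sup>k\<close> on these sets; the orbits that do
  not have full size consist of the sets fixed by translation by \<open>p\<^sup>k\<^sup>-\<^sup>1 e\<^sub>j\<close>. So modulo \<open>p\<^sup>k\<close>
  the periods can be lowered from \<open>p\<^sup>k\<close> to \<open>p\<^sup>k\<^sup>-\<^sup>1\<close> one coordinate at a time. For \<open>k = 1\<close> only
  the empty set remains, since a set with period 1 contains \<open>x + e\<^sub>j\<close> along with \<open>x\<close>.
\<close>

section \<open>Cyclic actions of prime power order\<close>

lemma funpow_closed:
  assumes "\<And>x. x \<in> X \<Longrightarrow> T x \<in> X" "x \<in> X"
  shows "(T ^^ n) x \<in> X"
  using assms by (induction n) auto

lemma funpow_mult_fixed:
  assumes "(T ^^ n) x = x"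
  shows "(T ^^ (n * a)) x = x"
  using assms by (induction a) (auto simp: funpow_add)

text \<open>Bezout over the naturals writes a multiple of \<open>a\<close> as a multiple of
  \<open>b\<close> plus the gcd, so no inverse of \<open>T\<close> is needed.\<close>

lemma funpow_gcd_fixed:
  assumes "(T ^^ a) x = x" "(T ^^ b) x = x"
  shows "(T ^^ gcd a b) x = x"
proof (cases "a = 0")
  case False
  then obtain u v where uv: "a * u = b * v + gcd a b"
    using bezout_nat by blast
  have "x = (T ^^ (gcd a b + b * v)) x"
    using funpow_mult_fixed[OF assms(1), of u] uv by (simp add: add.commute)
  also have "\<dots> = (T ^^ gcd a b) x"
    using funpow_mult_fixed[OF assms(2), of v] by (simp add: funpow_add)
  finally show ?thesis by simp
qed (use assms in simp)

text \<open>If two iterates below \<open>p ^ k\<close> agree, their difference is a period of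
  \<open>x\<close>. Its gcd with \<open>p ^ k\<close> is then a period \<open>p ^ l\<close> with
  \<open>l < k\<close>, which makes \<open>p ^ (k - 1)\<close> a period too.\<close>

lemma inj_on_orbit_prime_power:
  assumes "prime p" "k \<ge> 1"
    and per: "(T ^^ (p ^ k)) x = x" and nfix: "(T ^^ (p ^ (k - 1))) x \<noteq> x"
  shows "inj_on (\<lambda>i. (T ^^ i) x) {..<p ^ k}"
proof -
  have "False" if ij: "i < j" "j < p ^ k" "(T ^^ i) x = (T ^^ j) x" for i j
  proof -
    \<comment> \<open>\<open>T\<close> is not assumed injective, so \<open>T ^^ i\<close> is not
      cancelled; another \<open>p ^ k - i\<close> steps lead back to \<open>x\<close>
      instead.\<close>
    have "x = (T ^^ (p ^ k - i + i)) x"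
      using per ij by simp
    also have "\<dots> = (T ^^ (p ^ k - i + j)) x"
      using ij by (simp only: funpow_add o_apply)
    also have "p ^ k - i + j = (j - i) + p ^ k"
      using ij by simp
    also have "(T ^^ \<dots>) x = (T ^^ (j - i)) x"
      using per by (simp only: funpow_add o_apply)
    finally have g: "(T ^^ gcd (j - i) (p ^ k)) x = x"
      using per by (intro funpow_gcd_fixed) auto
    obtain l where l: "l \<le> k" "gcd (j - i) (p ^ k) = p ^ l"
      using divides_primepow_nat[OF assms(1), of "gcd (j - i) (p ^ k)" k] by auto
    have "gcd (j - i) (p ^ k) \<le> j - i"
      using ij by (intro gcd_le1_nat) auto
    then have "l \<noteq> k"
      using l ij by auto
    then have "p ^ l dvd p ^ (k - 1)"
      using l by (intro le_imp_power_dvd) auto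
    then show False
      using nfix funpow_mult_fixed[OF g] l by (metis dvdE)
  qed
  then show ?thesis
    by (intro linorder_inj_onI') auto
qed

text \<open>Each orbit away from the fixed points of \<open>T ^^ (p ^ (k - 1))\<close> has exactly
  \<open>p ^ k\<close> elements, so the points that are not fixed contribute a multiple of
  \<open>p ^ k\<close>.\<close>

lemma card_cong_fixed_points_prime_power:
  assumes "prime p" "k \<ge> 1" "finite X" and closed: "\<And>x. x \<in> X \<Longrightarrow> T x \<in> X"
    and per: "\<And>x. x \<in> X \<Longrightarrow> (T ^^ (p ^ k)) x = x"
  shows "[card X = card {x \<in> X. (T ^^ (p ^ (k - 1))) x = x}] (mod p ^ k)"
proof -
  define q where "q = p ^ (k - 1)"
  define F where "F = {x \<in> X. (T ^^ q) x = x}"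
  define Y where "Y = X - F"
  define R where "R = {(x, y). x \<in> Y \<and> (\<exists>n. y = (T ^^ n) x)}"
  have pk: "p ^ k > 0"
    using assms(1) prime_gt_0_nat by simp
  \<comment> \<open>Any iterate can be continued back to \<open>x\<close>; this replaces an inverse
    of \<open>T\<close> in \<open>orbit_fixed\<close> and in the symmetry of
    \<open>R\<close>.\<close>
  have orbit_return: "\<exists>n'. (T ^^ (n' + n)) x = x" if "x \<in> X" for n x
  proof -
    have "n \<le> p ^ k * n"
      using mult_le_mono1[of 1 "p ^ k" n] pk by linarith
    then have "(T ^^ ((p ^ k * n - n) + n)) x = x"
      using funpow_mult_fixed[OF per[OF that], of n] by simp
    then show ?thesis by blast
  qed
  have orbit_fixed: "x \<in> F" if x: "x \<in> X" and "(T ^^ n) x \<in> F" for n x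
  proof -
    obtain n' where n': "(T ^^ (n' + n)) x = x"
      using orbit_return[OF x] by blast
    have "(T ^^ q) x = (T ^^ q) ((T ^^ (n' + n)) x)"
      by (simp only: n')
    also have "\<dots> = (T ^^ (q + (n' + n))) x"
      by (simp only: funpow_add o_apply)
    also have "q + (n' + n) = n' + (q + n)"
      by simp
    also have "(T ^^ \<dots>) x = (T ^^ n') ((T ^^ q) ((T ^^ n) x))"
      by (simp only: funpow_add o_apply)
    also have "(T ^^ q) ((T ^^ n) x) = (T ^^ n) x"
      using that by (simp add: F_def)
    also have "(T ^^ n') \<dots> = x"
      using n' by (simp add: funpow_add)
    finally show ?thesis
      using x by (simp add: F_def)
  qed
  have Yclosed: "(T ^^ n) x \<in> Y" if "x \<in> Y" for n x
    using that orbit_fixed funpow_closed[of X T, OF closed] unfolding Y_def by blast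
  have equiv: "equiv Y R"
  proof (rule equivI)
    show "R \<subseteq> Y \<times> Y"
      using Yclosed by (auto simp: R_def)
    show "refl_on Y R"
    proof (rule refl_onI)
      fix x assume "x \<in> Y"
      moreover have "x = (T ^^ 0) x"
        by simp
      ultimately show "(x, x) \<in> R"
        unfolding R_def by blast
    qed
    show "sym R"
    proof (rule symI)
      fix x y assume "(x, y) \<in> R"
      then obtain n where n: "x \<in> Y" "y = (T ^^ n) x"
        by (auto simp: R_def)
      then obtain n' where "(T ^^ (n' + n)) x = x"
        using orbit_return by (auto simp: Y_def)
      then have "x = (T ^^ n') y"
        using n by (simp add: funpow_add)
      then show "(y, x) \<in> R"
        using n Yclosed by (auto simp: R_def)
    qed
    show "trans R"
    proof (rule transI)
      fix x y z assume "(x, y) \<in> R" "(y, z) \<in> R"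
      then obtain a b where "x \<in> Y" "y = (T ^^ a) x" "z = (T ^^ b) y"
        by (auto simp: R_def)
      then have "x \<in> Y" "z = (T ^^ (b + a)) x"
        by (simp_all add: funpow_add)
      then show "(x, z) \<in> R"
        by (auto simp: R_def)
    qed
  qed
  have dvd_class: "p ^ k dvd card C" if "C \<in> Y // R" for C
  proof -
    obtain x where x: "x \<in> Y" "C = R `` {x}"
      using \<open>C \<in> Y // R\<close> by (rule quotientE)
    have per_x: "(T ^^ (p ^ k)) x = x"
      using x per by (simp add: Y_def)
    have "C = (\<lambda>i. (T ^^ i) x) ` {..<p ^ k}"
    proof -
      have "(T ^^ n) x \<in> (\<lambda>i. (T ^^ i) x) ` {..<p ^ k}" for n
        using funpow_mod_eq[OF per_x, of n] pk
        by (intro image_eqI[of _ _ "n mod p ^ k"]) auto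
      then show ?thesis
        using x by (auto simp: R_def)
    qed
    moreover have "inj_on (\<lambda>i. (T ^^ i) x) {..<p ^ k}"
      using x per_x assms(1,2)
      by (intro inj_on_orbit_prime_power) (auto simp: Y_def F_def q_def)
    ultimately show ?thesis
      by (simp add: card_image)
  qed
  have "finite Y"
    using assms(3) by (simp add: Y_def)
  then have "p ^ k dvd card Y"
    using equiv dvd_class by (rule equiv_imp_dvd_card)
  moreover have "card X = card Y + card F"
    using assms(3) card_Diff_subset[of F X] card_mono[of X F]
    by (auto simp: Y_def F_def)
  ultimately show ?thesis
    by (auto simp: cong_def F_def q_def elim!: dvdE)
qed

section \<open>Periodic independent sets in the integer lattice\<close>

text \<open>\<open>extensional {..<d}\<close> models the lattice in the same encoding as the torus
  vertices. Excluding the positive neighbour of every \<open>x \<in> A\<close> also excludes the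
  negative ones.\<close>

definition periodic_indep :: "nat \<Rightarrow> (nat \<Rightarrow> nat) \<Rightarrow> (nat \<Rightarrow> int) set set" where
  "periodic_indep d m = {A. A \<subseteq> extensional {..<d} \<and>
     (\<forall>i<d. \<forall>x. x(i := x i + int (m i)) \<in> A \<longleftrightarrow> x \<in> A) \<and>
     (\<forall>i<d. \<forall>x\<in>A. x(i := x i + 1) \<notin> A)}"

definition shift :: "nat \<Rightarrow> int \<Rightarrow> (nat \<Rightarrow> int) set \<Rightarrow> (nat \<Rightarrow> int) set" where
  "shift j t A = {x. x(j := x j + t) \<in> A}"

lemma funpow_shift: "(shift j 1 ^^ n) A = shift j (int n) A"
  by (induction n) (auto simp: shift_def add_ac)

lemma shift_fixed_iff: "shift j t A = A \<longleftrightarrow> (\<forall>x. x(j := x j + t) \<in> A \<longleftrightarrow> x \<in> A)"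
  by (auto simp: shift_def)

lemma fun_upd_extensional_iff: "i \<in> S \<Longrightarrow> x(i := a) \<in> extensional S \<longleftrightarrow> x \<in> extensional S"
  by (auto simp: extensional_def)

text \<open>Translations of the lattice commute, so \<open>shift\<close> preserves both periods and
  independence; \<open>j < d\<close> preserves extensionality.\<close>

lemma shift_periodic_indep:
  assumes "A \<in> periodic_indep d m" "j < d"
  shows "shift j t A \<in> periodic_indep d m"
proof -
  have comm: "(x(i := x i + s))(j := (x(i := x i + s)) j + t)
      = (x(j := x j + t))(i := (x(j := x j + t)) i + s)" for x :: "nat \<Rightarrow> int" and i s
    by (auto simp: fun_eq_iff)
  have "x \<in> extensional {..<d}" if "x(j := x j + t) \<in> A" for x
    using assms that fun_upd_extensional_iff[of j "{..<d}" x "x j + t"]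
    unfolding periodic_indep_def by blast
  then have "shift j t A \<subseteq> extensional {..<d}"
    by (auto simp: shift_def)
  then show ?thesis
    using assms unfolding periodic_indep_def shift_def mem_Collect_eq
    by (auto simp: comm simp del: fun_upd_apply)
qed

lemma periodic_add_mult:
  fixes x :: "nat \<Rightarrow> int"
  assumes "\<forall>x. x(i := x i + c) \<in> A \<longleftrightarrow> x \<in> A"
  shows "x(i := x i + c * t) \<in> A \<longleftrightarrow> x \<in> A"
proof -
  have nat: "x(i := x i + c * int n) \<in> A \<longleftrightarrow> x \<in> A" for n x
  proof (induction n arbitrary: x)
    case (Suc n)
    show ?case
      using Suc[of "x(i := x i + c)"] assms[rule_format, of x]
      by (simp add: algebra_simps del: fun_upd_apply) (simp add: add_ac)
  qed simp
  show ?thesis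
  proof (cases "t \<ge> 0")
    case True
    then show ?thesis using nat[of x "nat t"] by simp
  next
    case False
    \<comment> \<open>For negative \<open>t\<close>, start at the translated point and climb
      \<open>- t\<close> periods back to \<open>x\<close>.\<close>
    then show ?thesis using nat[of "x(i := x i + c * t)" "nat (- t)"] by simp
  qed
qed

lemma periodic_indep_dvd:
  assumes "m j dvd m' j" "\<And>i. i \<noteq> j \<Longrightarrow> m i = m' i"
  shows "periodic_indep d m \<subseteq> periodic_indep d m'"
proof
  fix A assume A: "A \<in> periodic_indep d m"
  obtain c where c: "m' j = m j * c"
    using assms(1) by (rule dvdE)
  have "x(i := x i + int (m' i)) \<in> A \<longleftrightarrow> x \<in> A" if "i < d" for i x
    using A that periodic_add_mult[of i "int (m i)" A x "int c"] c assms(2)[of i]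
    by (cases "i = j") (auto simp: periodic_indep_def)
  then show "A \<in> periodic_indep d m'"
    using A by (simp add: periodic_indep_def)
qed

text \<open>The orbit count is applied to the unit translation \<open>shift j 1\<close>: being fixed
  by its iterate of order \<open>p ^ (k - 1)\<close> means having that period in coordinate
  \<open>j\<close>.\<close>

lemma card_periodic_indep_cong:
  assumes "prime p" "k \<ge> 1" "finite (periodic_indep d m)" "j < d" "m j = p ^ k"
  shows "[card (periodic_indep d m) = card (periodic_indep d (m(j := p ^ (k - 1))))] (mod p ^ k)"
proof -
  let ?X = "periodic_indep d m" and ?m' = "m(j := p ^ (k - 1))"
  have "A \<in> periodic_indep d ?m' \<longleftrightarrow> A \<in> ?X \<and> shift j (int (p ^ (k - 1))) A = A" for A
  proof
    assume A: "A \<in> periodic_indep d ?m'"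
    have "A \<in> ?X"
      using periodic_indep_dvd[of ?m' j m d] A assms(5) by (auto simp: le_imp_power_dvd)
    then show "A \<in> ?X \<and> shift j (int (p ^ (k - 1))) A = A"
      using A assms(4) unfolding shift_fixed_iff periodic_indep_def by auto
  next
    assume A: "A \<in> ?X \<and> shift j (int (p ^ (k - 1))) A = A"
    then show "A \<in> periodic_indep d ?m'"
      unfolding shift_fixed_iff periodic_indep_def by auto
  qed
  then have "periodic_indep d ?m' = {A \<in> ?X. (shift j 1 ^^ (p ^ (k - 1))) A = A}"
    unfolding funpow_shift by blast
  moreover have "(shift j 1 ^^ (p ^ k)) A = A" if "A \<in> ?X" for A
    using that assms(4,5) unfolding funpow_shift shift_fixed_iff periodic_indep_def by auto
  ultimately show ?thesis
    using card_cong_fixed_points_prime_power[OF assms(1-3), of "shift j 1"]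
      shift_periodic_indep assms(4) by simp
qed

lemma card_periodic_indep_cong_all:
  assumes "prime p" "k \<ge> 1" "finite (periodic_indep d (\<lambda>_. p ^ k))"
  shows "[card (periodic_indep d (\<lambda>_. p ^ k)) = card (periodic_indep d (\<lambda>_. p ^ (k - 1)))] (mod p ^ k)"
proof -
  \<comment> \<open>In \<open>m j\<close> the coordinates below \<open>j\<close> already have the
    lowered period. The induction carries finiteness along because each lowering step requires
    it.\<close>
  define m where "m j = (\<lambda>i. if i < j then p ^ (k - 1) else p ^ k)" for j :: nat
  have m_Suc: "m (Suc j) = (m j)(j := p ^ (k - 1))" for j
    by (auto simp: m_def fun_eq_iff)
  have "finite (periodic_indep d (m j)) \<and>
      [card (periodic_indep d (\<lambda>_. p ^ k)) = card (periodic_indep d (m j))] (mod p ^ k)"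
    if "j \<le> d" for j
    using that
  proof (induction j)
    case 0
    then show ?case
      using assms by (simp add: m_def)
  next
    case (Suc j)
    have "periodic_indep d (m (Suc j)) \<subseteq> periodic_indep d (m j)"
      by (rule periodic_indep_dvd[of _ j]) (auto simp: m_def le_imp_power_dvd)
    moreover have "[card (periodic_indep d (m j)) = card (periodic_indep d (m (Suc j)))] (mod p ^ k)"
      unfolding m_Suc using Suc assms by (intro card_periodic_indep_cong) (auto simp: m_def)
    ultimately show ?case
      using Suc by (auto intro: finite_subset cong_trans)
  qed
  from this[of d]
  have "[card (periodic_indep d (\<lambda>_. p ^ k)) = card (periodic_indep d (m d))] (mod p ^ k)"
    by simp
  moreover have "periodic_indep d (m d) = periodic_indep d (\<lambda>_. p ^ (k - 1))"
    by (auto simp: periodic_indep_def m_def)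
  ultimately show ?thesis
    by simp
qed

text \<open>\<open>d \<ge> 1\<close> supplies a coordinate in which period 1 and independence
  contradict each other at any member.\<close>

lemma periodic_indep_1:
  assumes "d \<ge> 1"
  shows "periodic_indep d (\<lambda>_. 1) = {{}}"
  using assms by (fastforce simp: periodic_indep_def)

section \<open>Independent sets of the torus\<close>

lemma torus_group_carrier:
  assumes "n \<ge> 1"
  shows "carrier (torus_group d n) = {..<d} \<rightarrow>\<^sub>E {0..<int n}"
  using assms by (simp add: torus_group_def carrier_integer_mod_group)

lemma torus_group_mult_unit_vec:
  assumes "n \<ge> 1" "x \<in> carrier (torus_group d n)" "i < d"
  shows "x \<otimes>\<^bsub>torus_group d n\<^esub> unit_vec d n i = x(i := (x i + 1) mod int n)"
proof
  fix j
  have x: "x \<in> {..<d} \<rightarrow>\<^sub>E {0..<int n}"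
    using assms torus_group_carrier by simp
  show "(x \<otimes>\<^bsub>torus_group d n\<^esub> unit_vec d n i) j = (x(i := (x i + 1) mod int n)) j"
  proof (cases "j < d")
    case True
    \<comment> \<open>The product reduces every coordinate mod \<open>n\<close>; for
      \<open>j \<noteq> i\<close> this changes nothing because \<open>x j\<close> is already a
      residue.\<close>
    then have "x j \<in> {0..<int n}"
      using PiE_mem[OF x, of j] by simp
    then show ?thesis
      using True by (auto simp: torus_group_def unit_vec_def mult_integer_mod_group mod_simps)
  next
    case False
    then show ?thesis
      using PiE_arb[OF x, of j] assms(3) by (auto simp: torus_group_def)
  qed
qed

lemma unit_vec_neq_one:
  assumes "n \<ge> 2" "i < d"
  shows "unit_vec d n i \<noteq> \<one>\<^bsub>torus_group d n\<^esub>"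
proof
  assume "unit_vec d n i = \<one>\<^bsub>torus_group d n\<^esub>"
  then have "unit_vec d n i i = \<one>\<^bsub>torus_group d n\<^esub> i"
    by simp
  then show False
    using assms by (simp add: unit_vec_def torus_group_def)
qed

text \<open>A step from \<open>x\<close> to \<open>y\<close> by an inverse generator is a step from
  \<open>y\<close> to \<open>x\<close> by the generator. For \<open>n \<ge> 2\<close> no generator
  is the identity, so removing the identity loses nothing.\<close>

lemma torus_graph_arcs_iff:
  assumes "n \<ge> 2" "x \<in> carrier (torus_group d n)" "y \<in> carrier (torus_group d n)"
  shows "(x, y) \<in> parcs (torus_graph d n) \<longleftrightarrow>
    (\<exists>i<d. y = x(i := (x i + 1) mod int n) \<or> x = y(i := (y i + 1) mod int n))"
proof -
  let ?G = "torus_group d n"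
  interpret group ?G by (rule group_torus_group)
  have n: "n \<ge> 1"
    using assms(1) by simp
  have uc: "unit_vec d n i \<in> carrier ?G" for i
    using unit_vec_closed[OF n] .
  have gens: "torus_gens d n = unit_vec d n ` {..<d} \<union> (\<lambda>i. inv\<^bsub>?G\<^esub> (unit_vec d n i)) ` {..<d}"
    using unit_vec_neq_one[OF assms(1)] uc unfolding torus_gens_def
    by (metis (no_types, lifting) Diff_empty Diff_insert0 UnE imageE inv_eq_1_iff lessThan_iff)
  have "y = x \<otimes>\<^bsub>?G\<^esub> inv\<^bsub>?G\<^esub> unit_vec d n i \<longleftrightarrow> x = y \<otimes>\<^bsub>?G\<^esub> unit_vec d n i" for i
    using assms(2,3) uc inv_solve_right by metis
  then have "(x, y) \<in> parcs (torus_graph d n) \<longleftrightarrow>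
      (\<exists>i<d. y = x \<otimes>\<^bsub>?G\<^esub> unit_vec d n i \<or> x = y \<otimes>\<^bsub>?G\<^esub> unit_vec d n i)"
    using assms(2,3) by (auto simp: torus_graph_def cayley_graph_def gens)
  then show ?thesis
    using torus_group_mult_unit_vec[OF n] assms(2,3) by auto
qed

lemma independent_set_torus_graph_iff:
  assumes "n \<ge> 2"
  shows "independent_set (torus_graph d n) I \<longleftrightarrow>
    I \<subseteq> ({..<d} \<rightarrow>\<^sub>E {0..<int n}) \<and> (\<forall>i<d. \<forall>x\<in>I. x(i := (x i + 1) mod int n) \<notin> I)"
proof -
  have V: "pverts (torus_graph d n) = carrier (torus_group d n)"
    by (simp add: torus_graph_def cayley_graph_def)
  have C: "carrier (torus_group d n) = {..<d} \<rightarrow>\<^sub>E {0..<int n}"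
    using assms by (intro torus_group_carrier) simp
  show ?thesis
  proof (cases "I \<subseteq> carrier (torus_group d n)")
    case True
    then have "(x, y) \<in> parcs (torus_graph d n) \<longleftrightarrow>
      (\<exists>i<d. y = x(i := (x i + 1) mod int n) \<or> x = y(i := (y i + 1) mod int n))"
      if "x \<in> I" "y \<in> I" for x y
      using that torus_graph_arcs_iff[OF assms] by blast
    then have "(\<forall>u\<in>I. \<forall>v\<in>I. (u, v) \<notin> parcs (torus_graph d n)) \<longleftrightarrow>
        (\<forall>i<d. \<forall>x\<in>I. x(i := (x i + 1) mod int n) \<notin> I)"
      by (simp del: fun_upd_apply) blast
    then show ?thesis
      using True unfolding independent_set_def V C by simp
  next
    case False
    then show ?thesis
      unfolding independent_set_def V C by blast
  qed
qed

lemma periodic_indep_reduce: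
  assumes "A \<in> periodic_indep d (\<lambda>_. n)" "x \<in> extensional {..<d}"
  shows "(\<lambda>i\<in>{..<d}. x i mod int n) \<in> A \<longleftrightarrow> x \<in> A"
proof -
  define r where "r j = (\<lambda>i. if i < j then x i mod int n else x i)" for j :: nat
  have "r j \<in> A \<longleftrightarrow> x \<in> A" if "j \<le> d" for j
    using that
  proof (induction j)
    case (Suc j)
    \<comment> \<open>Reduction of one coordinate is translation by \<open>- (x j div int n)\<close>
      periods.\<close>
    have "r (Suc j) = (r j)(j := r j j + int n * (- (x j div int n)))"
      by (auto simp: r_def fun_eq_iff less_Suc_eq minus_mult_div_eq_mod)
    then have "r (Suc j) \<in> A \<longleftrightarrow> r j \<in> A"
      using periodic_add_mult[of j "int n" A "r j" "- (x j div int n)"] assms(1) Suc.prems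
      by (simp only: periodic_indep_def mem_Collect_eq) simp
    then show ?case
      using Suc by simp
  qed (simp add: r_def)
  moreover have "r d = (\<lambda>i\<in>{..<d}. x i mod int n)"
    using assms(2) by (auto simp: r_def fun_eq_iff extensional_def)
  ultimately show ?thesis
    by (metis order_refl)
qed

text \<open>Restriction to the fundamental box and pullback along coordinatewise reduction mod
  \<open>n\<close> are mutually inverse.\<close>

lemma bij_betw_periodic_indep:
  assumes "n \<ge> 2"
  shows "bij_betw (\<lambda>A. A \<inter> ({..<d} \<rightarrow>\<^sub>E {0..<int n}))
    (periodic_indep d (\<lambda>_. n)) {I. independent_set (torus_graph d n) I}"
proof -
  define C where "C = ({..<d} \<rightarrow>\<^sub>E {0..<int n})"
  define red where "red x = (\<lambda>i\<in>{..<d}. x i mod int n)" for x :: "nat \<Rightarrow> int"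
  \<comment> \<open>\<open>red\<close> forgets the values outside \<open>{..<d}\<close>, so
    extensionality is imposed separately.\<close>
  define lift where "lift I = {x \<in> extensional {..<d}. red x \<in> I}" for I
  have n: "int n > 0"
    using assms by simp
  have red_id: "red x = x" if "x \<in> C" for x
  proof
    fix i
    show "red x i = x i"
    proof (cases "i < d")
      case True
      then have "x i \<in> {0..<int n}"
        using PiE_mem[OF that[unfolded C_def], of i] by simp
      then show ?thesis using True by (simp add: red_def)
    next
      case False
      then show ?thesis using PiE_arb[OF that[unfolded C_def], of i] by (simp add: red_def)
    qed
  qed
  have C_ext: "C \<subseteq> extensional {..<d}"
    by (simp add: C_def PiE_def)
  have red_C: "red x \<in> C" for x
    using n by (simp add: red_def C_def PiE_iff)
  have red_add: "red (x(i := x i + t)) = (red x)(i := (red x i + t) mod int n)" if "i < d" for x i t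
    using that by (auto simp: red_def fun_eq_iff mod_simps)
  have indep: "independent_set (torus_graph d n) I \<longleftrightarrow>
      I \<subseteq> C \<and> (\<forall>i<d. \<forall>x\<in>I. x(i := (x i + 1) mod int n) \<notin> I)" for I
    unfolding C_def using independent_set_torus_graph_iff[OF assms] .
  show ?thesis
    unfolding C_def[symmetric]
  proof (rule bij_betwI[where g = lift])
    show "(\<lambda>A. A \<inter> C) \<in> periodic_indep d (\<lambda>_. n) \<rightarrow> {I. independent_set (torus_graph d n) I}"
    proof
      fix A assume A: "A \<in> periodic_indep d (\<lambda>_. n)"
      have "x(i := (x i + 1) mod int n) \<notin> A" if "i < d" "x \<in> A" "x \<in> C" for i x
      proof -
        \<comment> \<open>The lattice neighbour may leave the box; reducing it gives the cyclic
          neighbour without changing membership in \<open>A\<close>.\<close>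
        have "x(i := x i + 1) \<notin> A"
          using A that by (simp add: periodic_indep_def)
        moreover have "x(i := x i + 1) \<in> extensional {..<d}"
          using C_ext that by (subst fun_upd_extensional_iff) auto
        ultimately have "red (x(i := x i + 1)) \<notin> A"
          using periodic_indep_reduce[OF A] unfolding red_def by blast
        then show ?thesis
          using that by (simp add: red_add red_id)
      qed
      then show "A \<inter> C \<in> {I. independent_set (torus_graph d n) I}"
        by (auto simp: indep)
    qed
    show "lift \<in> {I. independent_set (torus_graph d n) I} \<rightarrow> periodic_indep d (\<lambda>_. n)"
    proof
      fix I assume I: "I \<in> {I. independent_set (torus_graph d n) I}"
      have "red (x(i := x i + int n)) = red x" if "i < d" for i x
        using that by (auto simp: red_def fun_eq_iff)
      then show "lift I \<in> periodic_indep d (\<lambda>_. n)"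
        using I unfolding periodic_indep_def lift_def
        by (auto simp: red_add indep fun_upd_extensional_iff simp del: fun_upd_apply)
    qed
    show "lift (A \<inter> C) = A" if "A \<in> periodic_indep d (\<lambda>_. n)" for A
    proof -
      have "A \<subseteq> extensional {..<d}"
        using that by (simp add: periodic_indep_def)
      then show ?thesis
        using periodic_indep_reduce[OF that] red_C by (auto simp: lift_def red_def)
    qed
    show "lift I \<inter> C = I" if "I \<in> {I. independent_set (torus_graph d n) I}" for I
      using that red_id C_ext by (auto simp: indep lift_def)
  qed
qed

lemma num_indep_sets_eq:
  assumes "n \<ge> 2"
  shows "num_indep_sets d n = card (periodic_indep d (\<lambda>_. n))"
  using bij_betw_same_card[OF bij_betw_periodic_indep[OF assms]]
  by (simp add: num_indep_sets_def)

text \<open>The lattice is infinite for \<open>d \<ge> 1\<close>, so finiteness is pulled back from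
  the torus along the bijection.\<close>

lemma finite_periodic_indep:
  assumes "n \<ge> 2"
  shows "finite (periodic_indep d (\<lambda>_. n))"
proof -
  have "{I. independent_set (torus_graph d n) I} \<subseteq> Pow ({..<d} \<rightarrow>\<^sub>E {0..<int n})"
    using independent_set_torus_graph_iff[OF assms] by blast
  then have "finite {I. independent_set (torus_graph d n) I}"
    by (rule finite_subset) (simp add: finite_PiE)
  then show ?thesis
    using bij_betw_finite[OF bij_betw_periodic_indep[OF assms]] by simp
qed

theorem theorem3p4:
  fixes d p :: nat
  assumes "d \<ge> 1" and "prime p"
  shows "[num_indep_sets d p = 1] (mod p) \<and>
    (\<forall>k\<ge>2. [num_indep_sets d (p ^ k) = num_indep_sets d (p ^ (k - 1))] (mod p ^ k))"
proof -
  have pow: "p ^ k \<ge> 2" if "k \<ge> 1" for k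
    using prime_ge_2_nat[OF assms(2)] self_le_power[of p k] that by linarith
  have step: "[num_indep_sets d (p ^ k) = card (periodic_indep d (\<lambda>_. p ^ (k - 1)))] (mod p ^ k)"
    if "k \<ge> 1" for k
    using card_periodic_indep_cong_all[OF assms(2) that finite_periodic_indep[OF pow[OF that]]]
    by (simp add: num_indep_sets_eq[OF pow[OF that]])
  \<comment> \<open>Here the lowered period is 1, where \<open>periodic_indep\<close> does not count
    independent sets of the torus: the one-vertex graph has two of them, but only the empty set is
    periodic and independent.\<close>
  have "[num_indep_sets d p = 1] (mod p)"
    using step[of 1] periodic_indep_1[OF assms(1)] by simp
  \<comment> \<open>Now \<open>k - 1 \<ge> 1\<close>, so the lowered period is at least 2 and the
    count translates back to the torus.\<close>
  moreover have "[num_indep_sets d (p ^ k) = num_indep_sets d (p ^ (k - 1))] (mod p ^ k)"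
    if "k \<ge> 2" for k
    using step[of k] num_indep_sets_eq[OF pow[of "k - 1"]] that by simp
  ultimately show ?thesis
    by blast
qed

end
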